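(* Let $n\ge 1$, and let $p=(0,\dots,0,1)^T$, $m=(0,\dots,0,-1)^T$ and $z=(0,\dots,0,0)^T$ in $\mathbb{Z}^n$. Then $(J_n,\{p,m,z\})$ is a full number system.
   Context: $J_n$ denotes the $n\times n$ Jordan block with eigenvalue $1$: the matrix with $1$'s on the diagonal and on the superdiagonal and $0$'s elsewhere. For $M\in\mathbb{Z}^{n\times n}$ and a finite set $\mathcal{D}\subset\mathbb{Z}^n$ (the digit set), a vector $v\in\mathbb{Z}^n$ has a representation in base $M$ with digit set $\mathcal{D}$ if there is a finite nonempty sequence $a_k,a_{k-1},\dots,a_0$ of elements of $\mathcal{D}$ with $v=M^ka_k+\dots+M a_1+a_0$. The pair $(M,\mathcal{D})$ is a full number system if every $v\in\mathbb{Z}^n$ has such a representation. *)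

theory Defs
  imports "Jordan_Normal_Form.Jordan_Normal_Form"
begin

text \<open>
  The digits are indexed as in the expansion \<open>v = M^k a_k + \<dots> + M a_1 + a_0\<close>; the range
  \<open>{..k}\<close> makes the digit sequence nonempty. Values of \<open>a\<close> beyond \<open>k\<close> are irrelevant.
\<close>

definition has_representation :: "nat \<Rightarrow> int mat \<Rightarrow> int vec set \<Rightarrow> int vec \<Rightarrow> bool" where
  "has_representation n M D v \<longleftrightarrow>
     (\<exists>(k :: nat) (a :: nat \<Rightarrow> int vec).
        (\<forall>i \<le> k. a i \<in> D) \<and>
        v = finsum_vec TYPE(int) n (\<lambda>i. (M ^\<^sub>m i) *\<^sub>v a i) {..k})"

definition full_number_system :: "nat \<Rightarrow> int mat \<Rightarrow> int vec set \<Rightarrow> bool" where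
  "full_number_system n M D \<longleftrightarrow>
     M \<in> carrier_mat n n \<and> finite D \<and> D \<subseteq> carrier_vec n \<and>
     (\<forall>v \<in> carrier_vec n. has_representation n M D v)"

end

theory Submission
  imports Defs
begin

text \<open>
  Since \<open>J_n^i e_n\<close> has the entries \<open>i choose j\<close>, a representation of \<open>v\<close> amounts to a polynomial
  \<open>P\<close> with coefficients in \<open>{-1, 0, 1}\<close> and a prescribed residue modulo \<open>(x - 1)^n\<close>. The residue
  is adjusted one power of \<open>x - 1\<close> at a time, so it suffices that every integer is the leading
  \<open>(x - 1)\<close>-adic coefficient \<open>Q(1)\<close> of some such \<open>P = (x - 1)^j Q\<close>. These integers form a group,
  because \<open>P + x^N P'\<close> with \<open>N > deg P\<close> again has coefficients in \<open>{-1, 0, 1}\<close>. If \<open>P\<close> yields the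
  integer \<open>1\<close> for \<open>j\<close>, then \<open>(x^a - 1) P\<close> with \<open>a > deg P\<close> yields \<open>a\<close> for \<open>j + 1\<close>, and the
  difference of two consecutive such \<open>a\<close> is \<open>1\<close>.
\<close>

definition digit_poly :: "int poly \<Rightarrow> bool" where
  "digit_poly P \<longleftrightarrow> (\<forall>i. coeff P i \<in> {-1, 0, 1})"

text \<open>The polynomial is congruent to t (x - 1)^j modulo (x - 1)^(j + 1). Q may vanish at 1, so
  t = 0 is a legitimate value.\<close>

definition leading_value :: "nat \<Rightarrow> int \<Rightarrow> bool" where
  "leading_value j t \<longleftrightarrow> (\<exists>Q. digit_poly ([:-1, 1:] ^ j * Q) \<and> poly Q 1 = t)"

lemma digit_poly_0: "digit_poly 0"
  by (simp add: digit_poly_def)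

lemma digit_poly_uminus: "digit_poly P \<Longrightarrow> digit_poly (- P)"
  unfolding digit_poly_def coeff_minus
  by (metis add.inverse_inverse insert_iff neg_0_equal_iff_equal singletonD)

text \<open>The supports are disjoint: P lives on exponents below N, the shifted Q on exponents from
  N on. Hence no two nonzero coefficients are ever added.\<close>

lemma digit_poly_add_shift:
  assumes "digit_poly P" "digit_poly Q" "degree P < N"
  shows "digit_poly (P + monom 1 N * Q)"
  using assms by (auto simp: digit_poly_def coeff_monom_mult coeff_eq_0)

lemma leading_value_add:
  assumes "leading_value j s" "leading_value j t"
  shows "leading_value j (s + t)"
proof -
  let ?y = "[:-1, 1:] :: int poly"
  obtain Q R where Q: "digit_poly (?y ^ j * Q)" "poly Q 1 = s"
    and R: "digit_poly (?y ^ j * R)" "poly R 1 = t"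
    using assms by (auto simp: leading_value_def)
  define N where "N = Suc (degree (?y ^ j * Q))"
  have "digit_poly (?y ^ j * Q + monom 1 N * (?y ^ j * R))"
    by (rule digit_poly_add_shift[OF Q(1) R(1)]) (simp add: N_def)
  moreover have "?y ^ j * Q + monom 1 N * (?y ^ j * R) = ?y ^ j * (Q + monom 1 N * R)"
    by (simp add: algebra_simps)
  moreover have "poly (Q + monom 1 N * R) 1 = s + t"
    using Q(2) R(2) by (simp add: poly_monom)
  ultimately show ?thesis
    unfolding leading_value_def by metis
qed

lemma leading_value_uminus:
  assumes "leading_value j t"
  shows "leading_value j (- t)"
proof -
  obtain Q where "digit_poly ([:-1, 1:] ^ j * Q)" "poly Q 1 = t"
    using assms by (auto simp: leading_value_def)
  then have "digit_poly ([:-1, 1:] ^ j * (- Q))" "poly (- Q) 1 = - t"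
    using digit_poly_uminus by fastforce+
  then show ?thesis
    unfolding leading_value_def by blast
qed

lemma leading_value_of_one:
  assumes "leading_value j 1"
  shows "leading_value j t"
proof -
  have nat: "leading_value j (int k)" for k
  proof (induction k)
    case 0
    show ?case
      using leading_value_add[OF assms leading_value_uminus[OF assms]] by simp
  next
    case (Suc k)
    then show ?case
      using leading_value_add[OF assms] by simp
  qed
  show ?thesis
    using nat leading_value_uminus[OF nat] by (cases t rule: int_cases2) auto
qed

lemma leading_value_Suc:
  assumes "digit_poly ([:-1, 1:] ^ j * Q)" "poly Q 1 = 1" "degree ([:-1, 1:] ^ j * Q) < a"
  shows "leading_value (Suc j) (int a)"
proof -
  let ?y = "[:-1, 1:] :: int poly"
  \<comment> \<open>G is the cofactor of x - 1 in x^a - 1. It supplies the extra factor x - 1, and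
    its value a at 1 becomes the new leading value.\<close>
  define G :: "int poly" where "G = (\<Sum>i<a. [:0, 1:] ^ i)"
  have "monom 1 a - 1 = ([:0, 1:] - 1) * G"
    unfolding G_def monom_altdef by (simp add: power_diff_1_eq)
  also have "[:0, 1:] - 1 = ?y"
    by (simp add: one_pCons)
  finally have G: "monom 1 a = ?y * G + 1"
    by (simp add: algebra_simps)
  have "digit_poly (- (?y ^ j * Q) + monom 1 a * (?y ^ j * Q))"
    by (rule digit_poly_add_shift) (use assms digit_poly_uminus in auto)
  moreover have "- (?y ^ j * Q) + monom 1 a * (?y ^ j * Q) = ?y ^ Suc j * (G * Q)"
    unfolding G power_Suc by (simp only: algebra_simps)
  moreover have "poly (G * Q) 1 = int a"
    using assms(2) by (simp add: G_def poly_sum)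
  ultimately show ?thesis
    unfolding leading_value_def by metis
qed

lemma leading_value_all: "leading_value j t"
proof (induction j arbitrary: t)
  case 0
  have "digit_poly 1"
    by (simp add: digit_poly_def)
  then have "leading_value 0 1"
    unfolding leading_value_def by (intro exI[of _ 1]) simp
  then show ?case
    by (rule leading_value_of_one)
next
  case (Suc j)
  obtain Q where Q: "digit_poly ([:-1, 1:] ^ j * Q)" "poly Q 1 = 1"
    using Suc.IH[of 1] by (auto simp: leading_value_def)
  define a where "a = Suc (degree ([:-1, 1:] ^ j * Q))"
  have "leading_value (Suc j) (int (Suc a))" "leading_value (Suc j) (int a)"
    by (rule leading_value_Suc[OF Q]; simp add: a_def)+
  then have "leading_value (Suc j) (int (Suc a) + - int a)"
    by (intro leading_value_add leading_value_uminus)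
  then have "leading_value (Suc j) 1"
    by simp
  then show ?case
    by (rule leading_value_of_one)
qed

lemma digit_poly_residue:
  "\<exists>P. digit_poly P \<and> [:-1, 1:] ^ n dvd R - P"
proof (induction n)
  case 0
  then show ?case
    using digit_poly_0 by auto
next
  case (Suc n)
  let ?y = "[:-1, 1:] :: int poly"
  obtain P S where P: "digit_poly P" and S: "R - P = ?y ^ n * S"
    using Suc.IH by (auto elim: dvdE)
  \<comment> \<open>Since x^N is 1 at x = 1, matching S and Q there makes S - x^N Q vanish at 1.
    This gains one more factor x - 1 in the error.\<close>
  obtain Q where Q: "digit_poly (?y ^ n * Q)" "poly Q 1 = poly S 1"
    using leading_value_all by (auto simp: leading_value_def)
  define N where "N = Suc (degree P)"
  have "digit_poly (P + monom 1 N * (?y ^ n * Q))"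
    by (rule digit_poly_add_shift[OF P Q(1)]) (simp add: N_def)
  moreover have "?y ^ Suc n dvd R - (P + monom 1 N * (?y ^ n * Q))"
  proof -
    have "poly (S - monom 1 N * Q) 1 = 0"
      using Q(2) by (simp add: poly_monom)
    then have "?y dvd S - monom 1 N * Q"
      by (simp only: poly_eq_0_iff_dvd)
    moreover have "R - (P + monom 1 N * (?y ^ n * Q)) = ?y ^ n * (S - monom 1 N * Q)"
      using S by (simp add: algebra_simps)
    ultimately show ?thesis
      by (simp only: power_Suc2 mult_dvd_mono dvd_refl)
  qed
  ultimately show ?case
    by blast
qed

text \<open>Expanding each (1 + x)^i shows that the binomial sums are the coefficients of P in
  powers of x - 1. This links Jordan block powers to residues modulo (x - 1)^n.\<close>

lemma coeff_pcompose_shift: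
  fixes P :: "'a :: comm_ring_1 poly"
  shows "coeff (P \<circ>\<^sub>p [:1, 1:]) j = (\<Sum>i\<le>degree P. coeff P i * of_nat (i choose j))"
proof -
  have binom: "coeff ([:1, 1:] ^ i) j = (of_nat (i choose j) :: 'a)" for i
  proof (cases "j \<le> i")
    case True
    then show ?thesis
      by (simp add: coeff_linear_poly_power)
  next
    case False
    have "degree ([:1, 1 :: 'a:] ^ i) \<le> i"
      using degree_power_le[of "[:1, 1 :: 'a:]" i] by simp
    with False show ?thesis
      by (simp add: coeff_eq_0 binomial_eq_0)
  qed
  show ?thesis
    by (simp add: pcompose_altdef poly_altdef coeff_sum degree_map_poly coeff_map_poly binom)
qed

lemma digit_poly_binomial_sums:
  fixes c :: "nat \<Rightarrow> int"
  obtains P where "digit_poly P"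
    "\<And>j. j < n \<Longrightarrow> (\<Sum>i\<le>degree P. coeff P i * int (i choose j)) = c j"
proof -
  \<comment> \<open>S(x - 1) is the polynomial whose expansion in powers of x - 1 has the
    coefficients c j. Substituting x + 1 later turns (x - 1)^n into x^n, which does not affect
    coefficients below n.\<close>
  define S where "S = (\<Sum>j<n. monom (c j) j)"
  obtain P U where P: "digit_poly P" and U: "S \<circ>\<^sub>p [:-1, 1:] - P = [:-1, 1:] ^ n * U"
    using digit_poly_residue by (metis dvdE)
  have "(S \<circ>\<^sub>p [:-1, 1:] - P) \<circ>\<^sub>p [:1, 1:] = S - P \<circ>\<^sub>p [:1, 1:]"
    by (simp add: pcompose_diff pcompose_assoc[symmetric] pcompose_pCons)
  moreover have "([:-1, 1:] ^ n * U) \<circ>\<^sub>p [:1, 1:] = monom 1 n * (U \<circ>\<^sub>p [:1, 1:])"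
    by (simp add: pcompose_mult pcompose_hom.hom_power pcompose_pCons monom_altdef)
  ultimately have eq: "P \<circ>\<^sub>p [:1, 1:] = S - monom 1 n * (U \<circ>\<^sub>p [:1, 1:])"
    using U by (metis diff_diff_eq2 add_diff_cancel_left')
  show thesis
  proof
    fix j assume "j < n"
    then show "(\<Sum>i\<le>degree P. coeff P i * int (i choose j)) = c j"
      using coeff_pcompose_shift[of P j] unfolding eq
      by (simp add: S_def coeff_sum coeff_monom_mult)
  qed (fact P)
qed

theorem theorem5p3:
  fixes n :: nat and p m z :: "int vec"
  assumes "n \<ge> 1"
    and "p = vec n (\<lambda>i. if i = n - 1 then 1 else 0)"
    and "m = vec n (\<lambda>i. if i = n - 1 then -1 else 0)"
    and "z = vec n (\<lambda>i. 0)"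
  shows "full_number_system n (jordan_block n 1) {p, m, z}"
proof -
  let ?J = "jordan_block n (1 :: int)"
  have "has_representation n ?J {p, m, z} v" if v: "v \<in> carrier_vec n" for v
  proof -
    \<comment> \<open>The index is reversed because row r of the last column of
      \<open>?J ^\<^sub>m i\<close> holds i choose (n - 1 - r).\<close>
    obtain P where P: "digit_poly P"
      and sums: "\<And>j. j < n \<Longrightarrow>
        (\<Sum>i\<le>degree P. coeff P i * int (i choose j)) = v $ (n - 1 - j)"
      using digit_poly_binomial_sums[of n "\<lambda>j. v $ (n - 1 - j)"] by blast
    define a where "a i = coeff P i \<cdot>\<^sub>v p" for i
    have "a i \<in> {p, m, z}" for i
    proof -
      have "coeff P i \<in> {-1, 0, 1}"
        using P by (simp add: digit_poly_def)
      moreover have "(-1) \<cdot>\<^sub>v p = m" "0 \<cdot>\<^sub>v p = z" "1 \<cdot>\<^sub>v p = p"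
        by (auto simp: assms)
      ultimately show ?thesis
        unfolding a_def by auto
    qed
    \<comment> \<open>The top index is \<open>degree P\<close>; for P = 0 this is 0, which leaves
      the single digit z, so the sequence is nonempty.\<close>
    moreover have "v = finsum_vec TYPE(int) n (\<lambda>i. (?J ^\<^sub>m i) *\<^sub>v a i) {..degree P}"
      (is "v = ?s")
    proof (rule eq_vecI)
      have carrier: "(\<lambda>i. (?J ^\<^sub>m i) *\<^sub>v a i) \<in> {..degree P} \<rightarrow> carrier_vec n"
        by (auto simp: a_def assms intro!: mult_mat_vec_carrier)
      then have s: "?s \<in> carrier_vec n"
        by (rule finsum_vec_closed)
      then show "dim_vec v = dim_vec ?s"
        using v by simp
      fix r assume "r < dim_vec ?s"
      with s have r: "r < n"
        by simp
      \<comment> \<open>Each digit is a multiple of the last unit vector, so only the last column of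
        the power contributes.\<close>
      have entry: "((?J ^\<^sub>m i) *\<^sub>v a i) $ r = coeff P i * int (i choose (n - 1 - r))" for i
      proof -
        have "((?J ^\<^sub>m i) *\<^sub>v a i) $ r =
            (\<Sum>l<n. (?J ^\<^sub>m i) $$ (r, l) * (if l = n - 1 then coeff P i else 0))"
          using r by (auto simp: scalar_prod_def a_def assms jordan_block_pow
              atLeast0LessThan intro!: sum.cong)
        also have "\<dots> = (?J ^\<^sub>m i) $$ (r, n - 1) * coeff P i"
          using assms(1) by (simp add: if_distrib cong: if_cong)
        also have "\<dots> = coeff P i * int (i choose (n - 1 - r))"
          using r by (auto simp: jordan_block_pow)
        finally show ?thesis .
      qed
      have "?s $ r = (\<Sum>i\<le>degree P. ((?J ^\<^sub>m i) *\<^sub>v a i) $ r)"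
        using carrier r by (intro index_finsum_vec) auto
      also have "\<dots> = v $ (n - 1 - (n - 1 - r))"
        unfolding entry using r by (intro sums) simp
      finally show "v $ r = ?s $ r"
        using r by simp
    qed
    ultimately show ?thesis
      unfolding has_representation_def by blast
  qed
  then show ?thesis
    by (auto simp: full_number_system_def assms)
qed

end
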